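(* For every integer $k\ge2$, the $2k$-beachball graph $B_{2k}$ is common.
   Context: For a graph $H$ and a graphon $W$ (a measurable symmetric function $W:[0,1]^2\to[0,1]$), let $t_H(W)=\int_{[0,1]^{V(H)}}\prod_{uv\in E(H)}W(x_u,x_v)\,dx$ and $m_H(W)=t_H(W)+t_H(1-W)$. A graph $H$ is common if $m_H(W)\ge 2^{1-e(H)}$ for every graphon $W$. The $m$-beachball $B_m$ is obtained by gluing two copies of the $m$-wheel along their rim $m$-cycle; equivalently, it is an $m$-cycle together with two non-adjacent new vertices each adjacent to all $m$ vertices of the cycle (so $B_4=K_{2,2,2}$). *)

theory Defs
  imports "HOL-Analysis.Analysis"
begin

definition simple_graph :: "nat set \<Rightarrow> nat set set \<Rightarrow> bool" where
  "simple_graph V E \<longleftrightarrow> finite V \<and> (\<forall>e\<in>E. e \<subseteq> V \<and> card e = 2)"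

text \<open>A graphon: a measurable symmetric function [0,1]^2 \<rightarrow> [0,1]
(only its values on the unit square are relevant).\<close>

definition graphon :: "(real \<Rightarrow> real \<Rightarrow> real) \<Rightarrow> bool" where
  "graphon W \<longleftrightarrow>
     (\<lambda>(x, y). W x y) \<in> borel_measurable borel \<and>
     (\<forall>x y. W x y = W y x) \<and>
     (\<forall>x\<in>{0..1}. \<forall>y\<in>{0..1}. 0 \<le> W x y \<and> W x y \<le> 1)"

definition unit_interval :: "real measure" where
  "unit_interval = restrict_space lborel {0..1}"

definition hom_density :: "nat set \<Rightarrow> nat set set \<Rightarrow> (real \<Rightarrow> real \<Rightarrow> real) \<Rightarrow> real" where
  "hom_density V E W =
     (\<integral>x. (\<Prod>e\<in>E. W (x (Min e)) (x (Max e))) \<partial>(PiM V (\<lambda>_. unit_interval)))"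

definition m_density :: "nat set \<Rightarrow> nat set set \<Rightarrow> (real \<Rightarrow> real \<Rightarrow> real) \<Rightarrow> real" where
  "m_density V E W = hom_density V E W + hom_density V E (\<lambda>x y. 1 - W x y)"

definition common :: "nat set \<Rightarrow> nat set set \<Rightarrow> bool" where
  "common V E \<longleftrightarrow> (\<forall>W. graphon W \<longrightarrow> m_density V E W \<ge> 2 powr (1 - real (card E)))"

definition beachball_V :: "nat \<Rightarrow> nat set" where
  "beachball_V m = {0..<m+2}"

definition beachball_E :: "nat \<Rightarrow> nat set set" where
  "beachball_E m = {{i, (i + 1) mod m} | i. i < m} \<union> {{i, m} | i. i < m} \<union> {{i, m + 1} | i. i < m}"

end

theory Submission
  imports Defs "HOL-Probability.Probability"
begin

text \<open>
  Fix the two apexes \<open>u\<close>, \<open>v\<close> and put \<open>d(x) = W(u,x) W(v,x)\<close>, \<open>c = \<integral>d\<close>, \<open>a = \<integral>\<integral>d(x) W(x,y) d(y)\<close>.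
  The \<open>2k\<close>-cycle weighted by \<open>d\<close> is the trace of the \<open>2k\<close>-th power of a symmetric operator with
  Rayleigh quotient \<open>a/c\<close> at \<open>\<surd>d\<close>, so its density is at least \<open>(a/c)^(2k)\<close>.
  With \<open>Y = 8a/c\<close> and \<open>X = 4c\<close>, Bernoulli's inequality and \<open>Y^4 \<ge> 4XY - 2X - X^2\<close> bound
  \<open>Y^(2k)\<close> from below by an expression linear in \<open>a\<close>, \<open>c\<close>, \<open>c^2\<close>; these are equalities in the
  quasirandom case \<open>X = Y = 1\<close>.
  By Fubini the average of \<open>a\<close> over \<open>u\<close>, \<open>v\<close> is \<open>\<integral>\<integral>W c^2\<close>, so after adding the contributions of \<open>W\<close> and
  \<open>1 - W\<close> everything is a polynomial in \<open>f = 2W - 1\<close>, its degrees \<open>\<epsilon>\<close> and its codegrees \<open>n\<close>,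
  which is nonnegative on average after completing a square.
\<close>

subsection \<open>Bounded kernels and their powers\<close>

lemma (in prob_space) integrable_unit_bounded:
  fixes f :: "'a \<Rightarrow> real"
  assumes "f \<in> borel_measurable M" "\<And>x. \<bar>f x\<bar> \<le> 1"
  shows "integrable M f"
  using assms by (intro integrable_const_bound[where B=1]) auto

lemma (in prob_space) abs_integral_le_1:
  fixes f :: "'a \<Rightarrow> real"
  assumes "\<And>x. \<bar>f x\<bar> \<le> 1"
  shows "\<bar>\<integral>x. f x \<partial>M\<bar> \<le> 1"
proof (cases "integrable M f")
  case True
  have "\<bar>\<integral>x. f x \<partial>M\<bar> \<le> (\<integral>x. \<bar>f x\<bar> \<partial>M)"
    by (rule integral_abs_bound)
  also have "\<dots> \<le> (\<integral>x. 1 \<partial>M)"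
    using True assms by (intro integral_mono) auto
  finally show ?thesis
    by (simp add: prob_space)
qed (simp add: not_integrable_integral_eq)

text \<open>The quadratic form \<open>quad\<close> in \<open>s\<close> and \<open>t\<close> is
  nonnegative. If \<open>?B\<close> is positive, the choice \<open>s = ?B\<close>,
  \<open>t = ?C\<close> yields the discriminant inequality; if \<open>?B = 0\<close>, the choice
  \<open>s = ?C\<close> leaves an expression linear in \<open>t\<close>, which stays nonnegative
  only when \<open>?C = 0\<close>.\<close>

lemma Cauchy_Schwarz_integral:
  fixes f g :: "'a \<Rightarrow> real"
  assumes f: "integrable M (\<lambda>x. (f x)\<^sup>2)" and g: "integrable M (\<lambda>x. (g x)\<^sup>2)"
    and fg: "integrable M (\<lambda>x. f x * g x)"
  shows "(\<integral>x. f x * g x \<partial>M)\<^sup>2 \<le> (\<integral>x. (f x)\<^sup>2 \<partial>M) * (\<integral>x. (g x)\<^sup>2 \<partial>M)"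
proof -
  let ?A = "\<integral>x. (f x)\<^sup>2 \<partial>M" and ?B = "\<integral>x. (g x)\<^sup>2 \<partial>M" and ?C = "\<integral>x. f x * g x \<partial>M"
  have quad: "0 \<le> s\<^sup>2 * ?A - 2 * s * t * ?C + t\<^sup>2 * ?B" for s t
  proof -
    have "0 \<le> (\<integral>x. (s * f x - t * g x)\<^sup>2 \<partial>M)"
      by simp
    also have "\<dots> = (\<integral>x. s\<^sup>2 * (f x)\<^sup>2 - 2 * s * t * (f x * g x) + t\<^sup>2 * (g x)\<^sup>2 \<partial>M)"
      by (simp add: power2_eq_square algebra_simps)
    also have "\<dots> = s\<^sup>2 * ?A - 2 * s * t * ?C + t\<^sup>2 * ?B"
      using f g fg by simp
    finally show ?thesis .
  qed
  have B: "0 \<le> ?B"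
    by simp
  show ?thesis
  proof (cases "?B = 0")
    case False
    have "0 \<le> ?B * (?A * ?B - ?C\<^sup>2)"
      using quad[of ?B ?C] by (simp add: power2_eq_square algebra_simps)
    moreover have "0 < ?B"
      using False B by linarith
    ultimately have "0 \<le> ?A * ?B - ?C\<^sup>2"
      by (simp only: zero_le_mult_iff) linarith
    then show ?thesis
      by linarith
  next
    case True
    have "0 \<le> (?C)\<^sup>2 * ?A - 2 * ?C * ?C * t" for t
      using quad[of ?C t] True by (simp add: algebra_simps)
    from this[of "?A"] this[of "?A + 1"] have "?C\<^sup>2 * (?A + 2) \<le> 0"
      by (simp add: power2_eq_square algebra_simps)
    moreover have "0 \<le> ?A"
      by simp
    ultimately have "?C\<^sup>2 \<le> 0"
      by (smt (verit) mult_pos_pos)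
    with True show ?thesis
      by simp
  qed
qed

text \<open>The bound is demanded at all arguments, not only at points of the space, so that
  integrability goals carry no membership conditions.\<close>

definition unit_kernel :: "'a measure \<Rightarrow> ('a \<Rightarrow> 'a \<Rightarrow> real) \<Rightarrow> bool" where
  "unit_kernel M G \<longleftrightarrow>
     (\<lambda>(x, y). G x y) \<in> borel_measurable (M \<Otimes>\<^sub>M M) \<and> (\<forall>x y. \<bar>G x y\<bar> \<le> 1)"

lemma unit_kernel_bound: "unit_kernel M G \<Longrightarrow> \<bar>G x y\<bar> \<le> 1"
  by (simp add: unit_kernel_def)

lemma measurable_unit_kernel:
  assumes "unit_kernel M G" "f \<in> measurable N M" "g \<in> measurable N M"
  shows "(\<lambda>x. G (f x) (g x)) \<in> borel_measurable N"
  using assms measurable_Pair_compose_split unfolding unit_kernel_def by blast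

lemma abs_mult_le_1: "\<bar>a\<bar> \<le> 1 \<Longrightarrow> \<bar>b\<bar> \<le> 1 \<Longrightarrow> \<bar>a * b\<bar> \<le> (1::real)"
  by (simp add: abs_mult mult_le_one)

lemma abs_power2_le_1: "\<bar>a\<bar> \<le> 1 \<Longrightarrow> \<bar>a\<^sup>2\<bar> \<le> (1::real)"
  by (simp add: abs_square_le_1)

lemma abs_prod_le_1:
  fixes f :: "'a \<Rightarrow> real"
  assumes "\<And>i. i \<in> A \<Longrightarrow> \<bar>f i\<bar> \<le> 1"
  shows "\<bar>\<Prod>i\<in>A. f i\<bar> \<le> 1"
  unfolding abs_prod using assms by (intro prod_le_1) auto

lemmas unit_bounds = abs_mult_le_1 abs_power2_le_1 abs_prod_le_1

lemma Fubini_unit_bounded: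
  fixes F :: "'a \<Rightarrow> 'b \<Rightarrow> real"
  assumes "prob_space M" "prob_space N"
    and "(\<lambda>(x, y). F x y) \<in> borel_measurable (M \<Otimes>\<^sub>M N)" "\<And>x y. \<bar>F x y\<bar> \<le> 1"
  shows "(\<integral>x. (\<integral>y. F x y \<partial>N) \<partial>M) = (\<integral>y. (\<integral>x. F x y \<partial>M) \<partial>N)"
proof -
  interpret M: prob_space M by fact
  interpret N: prob_space N by fact
  interpret pair_prob_space M N ..
  have "integrable (M \<Otimes>\<^sub>M N) (\<lambda>(x, y). F x y)"
    using assms(3,4) by (intro P.integrable_unit_bounded) auto
  then show ?thesis
    by (rule Fubini_integral[symmetric])
qed

definition kernel_comp ::
  "'a measure \<Rightarrow> ('a \<Rightarrow> 'a \<Rightarrow> real) \<Rightarrow> ('a \<Rightarrow> 'a \<Rightarrow> real) \<Rightarrow> 'a \<Rightarrow> 'a \<Rightarrow> real" where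
  "kernel_comp M G H x y = (\<integral>z. G x z * H z y \<partial>M)"

lemma (in prob_space) unit_kernel_comp:
  assumes G: "unit_kernel M G" and H: "unit_kernel M H"
  shows "unit_kernel M (kernel_comp M G H)"
proof -
  note [measurable] = measurable_unit_kernel[OF G] measurable_unit_kernel[OF H]
  show ?thesis
    unfolding unit_kernel_def kernel_comp_def
    by (auto intro!: abs_integral_le_1 unit_bounds unit_kernel_bound[OF G] unit_kernel_bound[OF H])
qed

text \<open>An application of Fubini. The sections at \<open>x\<close> and \<open>y\<close> have to
  be measurable, hence the restriction to points of the space.\<close>

lemma (in prob_space) kernel_comp_assoc:
  assumes G: "unit_kernel M G" and H: "unit_kernel M H" and K: "unit_kernel M K"
    and x: "x \<in> space M" and y: "y \<in> space M"
  shows "kernel_comp M (kernel_comp M G H) K x y = kernel_comp M G (kernel_comp M H K) x y"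
proof -
  note [measurable] = measurable_unit_kernel[OF G] measurable_unit_kernel[OF H]
    measurable_unit_kernel[OF K]
  note b = unit_bounds unit_kernel_bound[OF G] unit_kernel_bound[OF H] unit_kernel_bound[OF K]
  have "(\<integral>z. (\<integral>w. G x w * H w z \<partial>M) * K z y \<partial>M) = (\<integral>z. (\<integral>w. G x w * H w z * K z y \<partial>M) \<partial>M)"
    by simp
  also have "\<dots> = (\<integral>w. (\<integral>z. G x w * H w z * K z y \<partial>M) \<partial>M)"
    using x y by (intro Fubini_unit_bounded prob_space_axioms unit_bounds b) measurable
  also have "\<dots> = (\<integral>w. G x w * (\<integral>z. H w z * K z y \<partial>M) \<partial>M)"
    by (simp add: mult.assoc)
  finally show ?thesis
    by (simp add: kernel_comp_def)
qed

text \<open>With index 0 standing for \<open>V\<close> itself (the identity operator has no kernel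
  in general), index \<open>n\<close> is the operator power \<open>n + 1\<close>. This explains the
  \<open>Suc\<close> in \<open>kernel_power_add\<close> and the \<open>2 * k - 1\<close> further
  down.\<close>

primrec kernel_power :: "'a measure \<Rightarrow> ('a \<Rightarrow> 'a \<Rightarrow> real) \<Rightarrow> nat \<Rightarrow> 'a \<Rightarrow> 'a \<Rightarrow> real" where
  "kernel_power M V 0 = V"
| "kernel_power M V (Suc n) = kernel_comp M (kernel_power M V n) V"

text \<open>Matches the form in \<open>integral_path\<close>, where the kernel at the start of the
  iteration varies.\<close>

lemma kernel_power_eq_funpow:
  "kernel_power M V n = ((\<lambda>G. kernel_comp M G V) ^^ n) V"
  by (induction n) auto

lemma kernel_comp_cong:
  assumes "\<And>z. z \<in> space M \<Longrightarrow> G x z = G' x z" "\<And>z. z \<in> space M \<Longrightarrow> H z y = H' z y"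
  shows "kernel_comp M G H x y = kernel_comp M G' H' x y"
  unfolding kernel_comp_def using assms by (intro Bochner_Integration.integral_cong) auto

lemma (in prob_space) unit_kernel_power:
  assumes "unit_kernel M V"
  shows "unit_kernel M (kernel_power M V n)"
  using assms by (induction n) (auto intro: unit_kernel_comp)

lemma (in prob_space) kernel_power_add:
  assumes V: "unit_kernel M V" and "x \<in> space M" "y \<in> space M"
  shows "kernel_power M V (Suc (i + j)) x y
    = kernel_comp M (kernel_power M V i) (kernel_power M V j) x y"
  using assms(2,3)
proof (induction j arbitrary: x y)
  case (Suc j)
  have "kernel_power M V (Suc (i + Suc j)) x y
    = kernel_comp M (kernel_comp M (kernel_power M V i) (kernel_power M V j)) V x y"
    using Suc by (auto intro!: kernel_comp_cong simp del: kernel_power.simps(2)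
        simp: kernel_power.simps(2)[of M V "Suc (i + j)"])
  then show ?case
    using Suc.prems V by (simp add: kernel_comp_assoc unit_kernel_power)
qed simp

text \<open>Transposition moves the last factor \<open>V\<close> to the front;
  \<open>kernel_power_add\<close> with \<open>i = 0\<close> shows that a power may be built up from
  either side.\<close>

lemma (in prob_space) kernel_power_sym:
  assumes V: "unit_kernel M V" and sym: "\<And>x y. V x y = V y x"
    and "x \<in> space M" "y \<in> space M"
  shows "kernel_power M V n x y = kernel_power M V n y x"
  using assms(3,4)
proof (induction n arbitrary: x y)
  case (Suc n)
  have "kernel_power M V (Suc n) x y = kernel_comp M V (kernel_power M V n) x y"
    using kernel_power_add[OF V Suc.prems, of 0 n] by simp
  also have "\<dots> = kernel_comp M (kernel_power M V n) V y x"
    unfolding kernel_comp_def using Suc sym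
    by (intro Bochner_Integration.integral_cong) (auto simp: mult.commute)
  finally show ?case
    by simp
qed (use sym in simp)

section \<open>Iterates of a symmetric kernel on a test function, and the Rayleigh quotient bound on
  traces\<close>

primrec kernel_apply :: "'a measure \<Rightarrow> ('a \<Rightarrow> 'a \<Rightarrow> real) \<Rightarrow> ('a \<Rightarrow> real) \<Rightarrow> nat \<Rightarrow> 'a \<Rightarrow> real" where
  "kernel_apply M V g 0 = g"
| "kernel_apply M V g (Suc n) = (\<lambda>x. \<integral>y. V x y * kernel_apply M V g n y \<partial>M)"

context prob_space
begin

context
  fixes V :: "'a \<Rightarrow> 'a \<Rightarrow> real" and g :: "'a \<Rightarrow> real"
  assumes V: "unit_kernel M V" and sym: "\<And>x y. V x y = V y x"
    and g [measurable]: "g \<in> borel_measurable M" and g_bound: "\<And>x. \<bar>g x\<bar> \<le> 1"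
begin

lemma measurable_kernel_apply [measurable]: "kernel_apply M V g n \<in> borel_measurable M"
proof (induction n)
  case (Suc n)
  note [measurable] = Suc measurable_unit_kernel[OF V]
  show ?case
    by simp
qed simp

lemma kernel_apply_bound: "\<bar>kernel_apply M V g n x\<bar> \<le> 1"
  by (induction n arbitrary: x)
     (auto intro!: abs_integral_le_1 unit_bounds g_bound unit_kernel_bound[OF V])

text \<open>\<open>kernel_apply\<close> starts from the identity but \<open>kernel_power\<close>
  from \<open>V\<close>, so the indices differ by one. Iteration multiplies by \<open>V\<close> on
  the left while \<open>kernel_power\<close> appends on the right; \<open>kernel_power_add\<close>
  reconciles the two.\<close>

lemma kernel_apply_power:
  assumes "x \<in> space M"
  shows "kernel_apply M V g (Suc n) x = (\<integral>y. kernel_power M V n x y * g y \<partial>M)"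
  using assms
proof (induction n arbitrary: x)
  case (Suc n)
  note [measurable] = measurable_unit_kernel[OF V] measurable_unit_kernel[OF unit_kernel_power[OF V]]
  note b = unit_bounds g_bound unit_kernel_bound[OF V] unit_kernel_bound[OF unit_kernel_power[OF V]]
  have "kernel_apply M V g (Suc (Suc n)) x
      = (\<integral>z. V x z * (\<integral>y. kernel_power M V n z y * g y \<partial>M) \<partial>M)"
    unfolding kernel_apply.simps(2)[of M V g "Suc n"]
    using Suc.IH by (intro Bochner_Integration.integral_cong) (auto simp del: kernel_apply.simps)
  also have "\<dots> = (\<integral>z. (\<integral>y. V x z * kernel_power M V n z y * g y \<partial>M) \<partial>M)"
    by (simp add: mult.assoc)
  also have "\<dots> = (\<integral>y. (\<integral>z. V x z * kernel_power M V n z y * g y \<partial>M) \<partial>M)"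
    using Suc.prems by (intro Fubini_unit_bounded prob_space_axioms b) measurable
  also have "\<dots> = (\<integral>y. kernel_comp M V (kernel_power M V n) x y * g y \<partial>M)"
    by (simp add: kernel_comp_def)
  also have "\<dots> = (\<integral>y. kernel_power M V (Suc n) x y * g y \<partial>M)"
    using kernel_power_add[OF V Suc.prems, of _ 0 n]
    by (intro Bochner_Integration.integral_cong) auto
  finally show ?case .
qed simp

lemma integrable_kernel_apply_mult:
  "integrable M (\<lambda>x. kernel_apply M V g m x * kernel_apply M V g n x)"
  by (intro integrable_unit_bounded unit_bounds kernel_apply_bound) simp

text \<open>Self-adjointness of the integral operator: Fubini together with the symmetry of
  \<open>V\<close>.\<close>

lemma kernel_apply_shift:
  "(\<integral>x. kernel_apply M V g (Suc m) x * kernel_apply M V g n x \<partial>M)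
   = (\<integral>x. kernel_apply M V g m x * kernel_apply M V g (Suc n) x \<partial>M)"
proof -
  note [measurable] = measurable_unit_kernel[OF V]
  note b = unit_bounds kernel_apply_bound unit_kernel_bound[OF V]
  let ?h = "kernel_apply M V g"
  have "(\<integral>x. ?h (Suc m) x * ?h n x \<partial>M) = (\<integral>x. (\<integral>y. V x y * ?h m y * ?h n x \<partial>M) \<partial>M)"
    by simp
  also have "\<dots> = (\<integral>y. (\<integral>x. V x y * ?h m y * ?h n x \<partial>M) \<partial>M)"
    by (intro Fubini_unit_bounded prob_space_axioms b) measurable
  also have "\<dots> = (\<integral>y. ?h m y * (\<integral>x. V y x * ?h n x \<partial>M) \<partial>M)"
    by (subst sym) (simp add: ac_simps flip: integral_mult_right_zero)
  finally show ?thesis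
    by simp
qed

text \<open>By self-adjointness the squared norm of iterate \<open>n + 1\<close> is the inner
  product of iterates \<open>n\<close> and \<open>n + 2\<close>, to which Cauchy-Schwarz
  applies.\<close>

lemma kernel_apply_log_convex:
  "(\<integral>x. (kernel_apply M V g (Suc n) x)\<^sup>2 \<partial>M)\<^sup>2
   \<le> (\<integral>x. (kernel_apply M V g n x)\<^sup>2 \<partial>M) * (\<integral>x. (kernel_apply M V g (Suc (Suc n)) x)\<^sup>2 \<partial>M)"
proof -
  have "(\<integral>x. (kernel_apply M V g (Suc n) x)\<^sup>2 \<partial>M)
      = (\<integral>x. kernel_apply M V g n x * kernel_apply M V g (Suc (Suc n)) x \<partial>M)"
    using kernel_apply_shift[of n "Suc n"] by (simp only: power2_eq_square)
  then show ?thesis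
    using Cauchy_Schwarz_integral[of M "kernel_apply M V g n" "kernel_apply M V g (Suc (Suc n))"]
      integrable_kernel_apply_mult by (simp only: power2_eq_square)
qed

text \<open>Log-convexity makes the ratios of consecutive squared norms nondecreasing, and
  Cauchy-Schwarz for \<open>g\<close> and its image bounds the first ratio below by the square of
  the Rayleigh quotient \<open>l\<close>.\<close>

lemma kernel_apply_growth:
  defines "l \<equiv> (\<integral>x. g x * (\<integral>y. V x y * g y \<partial>M) \<partial>M) / (\<integral>x. (g x)\<^sup>2 \<partial>M)"
  shows "l\<^sup>2 * (\<integral>x. (kernel_apply M V g n x)\<^sup>2 \<partial>M) \<le> (\<integral>x. (kernel_apply M V g (Suc n) x)\<^sup>2 \<partial>M)"
proof (induction n)
  case 0
  have "(\<integral>x. g x * (\<integral>y. V x y * g y \<partial>M) \<partial>M)\<^sup>2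
    \<le> (\<integral>x. (g x)\<^sup>2 \<partial>M) * (\<integral>x. (\<integral>y. V x y * g y \<partial>M)\<^sup>2 \<partial>M)"
    using Cauchy_Schwarz_integral[of M "kernel_apply M V g 0" "kernel_apply M V g 1"]
      integrable_kernel_apply_mult[of 0 0] integrable_kernel_apply_mult[of 0 1]
      integrable_kernel_apply_mult[of 1 1] by (simp add: power2_eq_square)
  moreover have "0 \<le> (\<integral>x. (g x)\<^sup>2 \<partial>M)"
    by simp
  \<comment> \<open>For \<open>c = 0\<close> the quotient is 0 by the convention for division, so
    the claim remains valid for a test function of norm zero.\<close>
  moreover have "(a / c)\<^sup>2 * c \<le> b" if "a\<^sup>2 \<le> c * b" "0 \<le> c" "0 \<le> b" for a b c :: real
    using that by (cases "c = 0") (auto simp: power2_eq_square divide_simps mult.commute)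
  ultimately show ?case
    by (simp add: l_def)
next
  case (Suc n)
  define s where "s n = (\<integral>x. (kernel_apply M V g n x)\<^sup>2 \<partial>M)" for n
  have nonneg: "0 \<le> s n" for n
    by (simp add: s_def)
  have "s (Suc n) * (l\<^sup>2 * s (Suc n)) = l\<^sup>2 * (s (Suc n))\<^sup>2"
    by (simp add: power2_eq_square)
  also have "\<dots> \<le> l\<^sup>2 * (s n * s (Suc (Suc n)))"
    using kernel_apply_log_convex[of n] by (intro mult_left_mono) (simp_all only: s_def zero_le_power2)
  also have "\<dots> \<le> s (Suc n) * s (Suc (Suc n))"
    using mult_right_mono[OF Suc nonneg[of "Suc (Suc n)"]] by (simp only: s_def mult.assoc)
  finally have "l\<^sup>2 * s (Suc n) \<le> s (Suc (Suc n))"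
    using nonneg[of "Suc n"] nonneg[of "Suc (Suc n)"]
    by (cases "s (Suc n) = 0") (auto simp: mult_le_cancel_left)
  then show ?case
    by (simp only: s_def)
qed

text \<open>The trace of the operator power \<open>2 * k\<close> is the squared Hilbert-Schmidt norm
  of the \<open>k\<close>-th power. That norm dominates the growth of \<open>g\<close> under
  \<open>k\<close> applications, which is at least \<open>l ^ k\<close> by
  \<open>kernel_apply_growth\<close>.\<close>

lemma Rayleigh_power_le_kernel_power:
  assumes "1 \<le> k"
  shows "((\<integral>x. g x * (\<integral>y. V x y * g y \<partial>M) \<partial>M) / (\<integral>x. (g x)\<^sup>2 \<partial>M)) ^ (2 * k)
    \<le> (\<integral>x. kernel_power M V (2 * k - 1) x x \<partial>M)"
proof -
  define l where "l = (\<integral>x. g x * (\<integral>y. V x y * g y \<partial>M) \<partial>M) / (\<integral>x. (g x)\<^sup>2 \<partial>M)"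
  define s where "s n = (\<integral>x. (kernel_apply M V g n x)\<^sup>2 \<partial>M)" for n
  define K where "K = kernel_power M V (k - 1)"
  have K: "unit_kernel M K"
    unfolding K_def by (rule unit_kernel_power[OF V])
  note [measurable] = measurable_unit_kernel[OF K]
  note b = unit_bounds g_bound unit_kernel_bound[OF K]
  have trace: "(\<integral>x. kernel_power M V (2 * k - 1) x x \<partial>M) = (\<integral>x. (\<integral>y. (K x y)\<^sup>2 \<partial>M) \<partial>M)"
  proof (rule Bochner_Integration.integral_cong[OF refl])
    fix x assume x: "x \<in> space M"
    have "kernel_power M V (2 * k - 1) x x = kernel_comp M K K x x"
    proof -
      have "2 * k - 1 = Suc (k - 1 + (k - 1))"
        using assms by simp
      then show ?thesis
        by (simp only: kernel_power_add[OF V x x] K_def)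
    qed
    also have "\<dots> = (\<integral>y. (K x y)\<^sup>2 \<partial>M)"
      unfolding kernel_comp_def K_def power2_eq_square
      using kernel_power_sym[OF V sym _ x] by (intro Bochner_Integration.integral_cong) auto
    finally show "kernel_power M V (2 * k - 1) x x = (\<integral>y. (K x y)\<^sup>2 \<partial>M)" .
  qed
  have growth: "(l\<^sup>2) ^ n * s 0 \<le> s n" for n
  proof (induction n)
    case (Suc n)
    have "(l\<^sup>2) ^ Suc n * s 0 \<le> l\<^sup>2 * s n"
      using mult_left_mono[OF Suc, of "l\<^sup>2"] by (simp add: mult.assoc)
    also have "\<dots> \<le> s (Suc n)"
      unfolding s_def l_def by (rule kernel_apply_growth)
    finally show ?case .
  qed simp
  have "s k = (\<integral>x. (\<integral>y. K x y * g y \<partial>M)\<^sup>2 \<partial>M)"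
    unfolding s_def K_def using kernel_apply_power[of _ "k - 1"] assms
    by (intro Bochner_Integration.integral_cong) (auto simp del: kernel_apply.simps)
  \<comment> \<open>Cauchy-Schwarz in \<open>y\<close> for each fixed \<open>x\<close>: the operator
    norm is at most the Hilbert-Schmidt norm.\<close>
  also have "\<dots> \<le> (\<integral>x. (\<integral>y. (K x y)\<^sup>2 \<partial>M) * s 0 \<partial>M)"
  proof (rule integral_mono)
    show "integrable M (\<lambda>x. (\<integral>y. K x y * g y \<partial>M)\<^sup>2)"
      by (intro integrable_unit_bounded b abs_integral_le_1) measurable
    show "integrable M (\<lambda>x. (\<integral>y. (K x y)\<^sup>2 \<partial>M) * s 0)"
      unfolding s_def kernel_apply.simps
      by (intro integrable_unit_bounded b abs_integral_le_1) measurable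
    fix x assume x: "x \<in> space M"
    show "(\<integral>y. K x y * g y \<partial>M)\<^sup>2 \<le> (\<integral>y. (K x y)\<^sup>2 \<partial>M) * s 0"
      unfolding s_def kernel_apply.simps using x
      by (intro Cauchy_Schwarz_integral integrable_unit_bounded b) measurable
  qed
  finally have "s k \<le> (\<integral>x. (\<integral>y. (K x y)\<^sup>2 \<partial>M) \<partial>M) * s 0"
    by simp
  with growth[of k] have le: "(l\<^sup>2) ^ k * s 0 \<le> (\<integral>x. (\<integral>y. (K x y)\<^sup>2 \<partial>M) \<partial>M) * s 0"
    by linarith
  have "0 \<le> s 0"
    by (simp add: s_def)
  show ?thesis
  proof (cases "s 0 = 0")
    case True
    \<comment> \<open>Division by zero gives \<open>l = 0\<close>; since \<open>k\<close> is
      positive the left side vanishes, and the trace is an integral of squares.\<close>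
    then have "l = 0"
      by (simp add: l_def s_def)
    then show ?thesis
      using assms trace by (simp add: power_0_left flip: l_def)
  next
    case False
    with \<open>0 \<le> s 0\<close> le show ?thesis
      by (simp add: trace[simplified] power_mult flip: l_def)
  qed
qed

end

end

subsection \<open>Path and cycle integrals\<close>

text \<open>\<open>G\<close> joins the two ends of the path. Integrating out the last vertex absorbs
  its path edge into this closing kernel and shortens the path, so the induction has to run over
  arbitrary, possibly asymmetric, \<open>G\<close>.\<close>

lemma (in prob_space) integral_path:
  assumes V: "unit_kernel M V" and sym: "\<And>x y. V x y = V y x" and G: "unit_kernel M G"
  shows "(\<integral>x. (\<Prod>i<n. V (x i) (x (Suc i))) * G (x 0) (x n) \<partial>Pi\<^sub>M {0..<Suc n} (\<lambda>_. M))
    = (\<integral>x. ((\<lambda>G. kernel_comp M G V) ^^ n) G x x \<partial>M)"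
  using G
proof (induction n arbitrary: G)
  case 0
  interpret product_sigma_finite "\<lambda>_::nat. M" ..
  note [measurable] = measurable_unit_kernel[OF 0]
  have "(\<integral>x. G (x 0) (x 0) \<partial>Pi\<^sub>M {0::nat} (\<lambda>_. M)) = (\<integral>x. G x x \<partial>M)"
    by (rule product_integral_singleton) measurable
  then show ?case
    by simp
next
  case (Suc n)
  interpret product_sigma_finite "\<lambda>_::nat. M" ..
  interpret I: prob_space "Pi\<^sub>M {0..<Suc (Suc n)} (\<lambda>_. M)"
    by (intro prob_space_PiM prob_space_axioms)
  note [measurable] = measurable_unit_kernel[OF V] measurable_unit_kernel[OF Suc.prems]
  note b = unit_bounds unit_kernel_bound[OF V] unit_kernel_bound[OF Suc.prems]
  let ?F = "\<lambda>x. (\<Prod>i<Suc n. V (x i) (x (Suc i))) * G (x 0) (x (Suc n))"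
  have int: "integrable (Pi\<^sub>M (insert (Suc n) {0..<Suc n}) (\<lambda>_. M)) ?F"
    unfolding atLeast0_lessThan_Suc[symmetric] by (intro I.integrable_unit_bounded b) measurable
  have "integral\<^sup>L (Pi\<^sub>M {0..<Suc (Suc n)} (\<lambda>_. M)) ?F
      = (\<integral>x. (\<integral>y. ?F (x(Suc n := y)) \<partial>M) \<partial>Pi\<^sub>M {0..<Suc n} (\<lambda>_. M))"
    by (subst atLeast0_lessThan_Suc, rule product_integral_insert[OF _ _ int]) auto
  also have "\<dots> = (\<integral>x. (\<Prod>i<n. V (x i) (x (Suc i))) * kernel_comp M G V (x 0) (x n)
      \<partial>Pi\<^sub>M {0..<Suc n} (\<lambda>_. M))"
  proof (rule Bochner_Integration.integral_cong[OF refl])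
    fix x
    have "?F (x(Suc n := y)) = (\<Prod>i<n. V (x i) (x (Suc i))) * (G (x 0) y * V y (x n))" for y
      using sym[of y "x n"] by simp
    then show "(\<integral>y. ?F (x(Suc n := y)) \<partial>M)
      = (\<Prod>i<n. V (x i) (x (Suc i))) * kernel_comp M G V (x 0) (x n)"
      by (simp only: kernel_comp_def integral_mult_right_zero)
  qed
  also have "\<dots> = (\<integral>x. ((\<lambda>G. kernel_comp M G V) ^^ n) (kernel_comp M G V) x x \<partial>M)"
    by (rule Suc.IH[OF unit_kernel_comp[OF Suc.prems V]])
  finally show ?case
    by (simp only: funpow_Suc_right o_def)
qed

text \<open>A cycle is a path with \<open>m - 1\<close> edges whose closing kernel is again
  \<open>V\<close>.\<close>

lemma (in prob_space) integral_cycle: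
  assumes V: "unit_kernel M V" and sym: "\<And>x y. V x y = V y x" and "1 \<le> m"
  shows "(\<integral>x. (\<Prod>i<m. V (x i) (x (Suc i mod m))) \<partial>Pi\<^sub>M {0..<m} (\<lambda>_. M))
    = (\<integral>x. kernel_power M V (m - 1) x x \<partial>M)"
proof -
  obtain n where m: "m = Suc n"
    using assms(3) by (cases m) auto
  have "(\<Prod>i<m. V (x i) (x (Suc i mod m))) = (\<Prod>i<n. V (x i) (x (Suc i))) * V (x 0) (x n)"
    for x :: "nat \<Rightarrow> 'a"
    using sym[of "x 0" "x n"] by (auto simp: m intro!: prod.cong)
  then have "(\<integral>x. (\<Prod>i<m. V (x i) (x (Suc i mod m))) \<partial>Pi\<^sub>M {0..<m} (\<lambda>_. M))
    = (\<integral>x. (\<Prod>i<n. V (x i) (x (Suc i))) * V (x 0) (x n) \<partial>Pi\<^sub>M {0..<m} (\<lambda>_. M))"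
    by (simp only:)
  then show ?thesis
    using integral_path[OF V sym V, of n] by (simp only: m kernel_power_eq_funpow diff_Suc_1)
qed

lemma pair_integral_unit_bounded:
  fixes F :: "'a \<Rightarrow> 'b \<Rightarrow> real"
  assumes "prob_space M" "prob_space N"
    and "(\<lambda>(x, y). F x y) \<in> borel_measurable (M \<Otimes>\<^sub>M N)" "\<And>x y. \<bar>F x y\<bar> \<le> 1"
  shows "(\<integral>p. F (fst p) (snd p) \<partial>(M \<Otimes>\<^sub>M N)) = (\<integral>x. (\<integral>y. F x y \<partial>N) \<partial>M)"
proof -
  interpret M: prob_space M by fact
  interpret N: prob_space N by fact
  interpret pair_prob_space M N ..
  have "integrable (M \<Otimes>\<^sub>M N) (\<lambda>(x, y). F x y)"
    using assms(3,4) by (intro P.integrable_unit_bounded) auto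
  from integral_fst'[OF this] show ?thesis
    by (simp add: case_prod_beta')
qed

subsection \<open>Cycles in the common neighbourhood of two apexes\<close>

definition codegree :: "'a measure \<Rightarrow> ('a \<Rightarrow> 'a \<Rightarrow> real) \<Rightarrow> 'a \<Rightarrow> 'a \<Rightarrow> real" where
  "codegree M W u v = (\<integral>x. W u x * W v x \<partial>M)"

text \<open>This is \<open>a\<close> as a function of the two apexes. Using the product measure lets
  a single application of Fubini exchange the pair of apexes with the pair of rim vertices.\<close>

definition edge_codegree :: "'a measure \<Rightarrow> ('a \<Rightarrow> 'a \<Rightarrow> real) \<Rightarrow> 'a \<Rightarrow> 'a \<Rightarrow> real" where
  "edge_codegree M W u v =
     (\<integral>q. (W u (fst q) * W v (fst q)) * W (fst q) (snd q) * (W u (snd q) * W v (snd q)) \<partial>(M \<Otimes>\<^sub>M M))"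

definition cycle_codegree :: "'a measure \<Rightarrow> nat \<Rightarrow> ('a \<Rightarrow> 'a \<Rightarrow> real) \<Rightarrow> 'a \<Rightarrow> 'a \<Rightarrow> real" where
  "cycle_codegree M m W u v =
     (\<integral>x. (\<Prod>i<m. W (x i) (x (Suc i mod m)) * (W u (x i) * W v (x i))) \<partial>Pi\<^sub>M {0..<m} (\<lambda>_. M))"

text \<open>Rotation of the rim, needed to share each vertex weight between the two rim edges at
  that vertex.\<close>

lemma Suc_mod_bij_betw: "bij_betw (\<lambda>i. Suc i mod m) {..<m} {..<m}"
proof (cases m)
  case (Suc n)
  have "(\<lambda>i. Suc i mod m) ` {..<m} = {..<m}"
  proof (intro equalityI subsetI)
    fix j assume j: "j \<in> {..<m}"
    show "j \<in> (\<lambda>i. Suc i mod m) ` {..<m}"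
    proof (cases j)
      case 0
      then show ?thesis
        using Suc by (intro image_eqI[where x=n]) auto
    next
      case (Suc i)
      then show ?thesis
        using j by (intro image_eqI[where x=i]) auto
    qed
  qed (use Suc in auto)
  then show ?thesis
    by (simp add: bij_betw_def eq_card_imp_inj_on)
qed (simp add: bij_betw_def)

context prob_space
begin

context
  fixes W :: "'a \<Rightarrow> 'a \<Rightarrow> real"
  assumes W: "unit_kernel M W" and sym: "\<And>x y. W x y = W y x" and nonneg: "\<And>x y. 0 \<le> W x y"
begin

text \<open>The integrand of \<open>a\<close> is that of \<open>c\<close> times factors in the unit
  interval, so \<open>a\<close> lies between 0 and \<open>c\<close>. This covers the zero
  denominator in \<open>a / c\<close>.\<close>

lemma edge_codegree_eq_0:
  assumes u: "u \<in> space M" and v: "v \<in> space M" and "codegree M W u v = 0"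
  shows "edge_codegree M W u v = 0"
proof -
  have M: "prob_space M"
    by (rule prob_space_axioms)
  interpret P: prob_space "M \<Otimes>\<^sub>M M"
    by (intro prob_space_pair prob_space_axioms)
  note [measurable] = measurable_unit_kernel[OF W]
  note b = unit_bounds unit_kernel_bound[OF W]
  have "edge_codegree M W u v \<le> (\<integral>q. W u (fst q) * W v (fst q) \<partial>(M \<Otimes>\<^sub>M M))"
    unfolding edge_codegree_def
  proof (rule integral_mono)
    fix q assume "q \<in> space (M \<Otimes>\<^sub>M M)"
    have "\<bar>W (fst q) (snd q) * (W u (snd q) * W v (snd q))\<bar> \<le> 1"
      by (intro b)
    then show "(W u (fst q) * W v (fst q)) * W (fst q) (snd q) * (W u (snd q) * W v (snd q))
      \<le> W u (fst q) * W v (fst q)"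
      using mult_left_le[of "W (fst q) (snd q) * (W u (snd q) * W v (snd q))" "W u (fst q) * W v (fst q)"]
        nonneg by (simp add: mult.assoc)
  qed (use u v in \<open>(intro P.integrable_unit_bounded b; measurable)\<close>)+
  also have "\<dots> = (\<integral>x. (\<integral>y. W u x * W v x \<partial>M) \<partial>M)"
    by (rule pair_integral_unit_bounded[OF M M]) (use u v in \<open>auto intro!: b\<close>)
  also have "\<dots> = 0"
    using assms(3) by (simp add: codegree_def prob_space)
  finally show ?thesis
    unfolding edge_codegree_def using nonneg
    by (intro antisym Bochner_Integration.integral_nonneg mult_nonneg_nonneg) auto
qed

text \<open>Weighting the cycle by the codegrees of the two apexes amounts to replacing \<open>W\<close> by the
  symmetric kernel \<open>\<surd>d(x) W(x,y) \<surd>d(y)\<close> with \<open>d(x) = W(u,x) W(v,x)\<close>; the test function is \<open>\<surd>d\<close>.\<close>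

lemma ratio_power_le_cycle_codegree:
  assumes u: "u \<in> space M" and v: "v \<in> space M" and "1 \<le> k"
  shows "(edge_codegree M W u v / codegree M W u v) ^ (2 * k) \<le> cycle_codegree M (2 * k) W u v"
proof -
  note [measurable] = measurable_unit_kernel[OF W]
  define d where "d x = W u x * W v x" for x
  have d_nonneg: "0 \<le> d x" for x
    unfolding d_def using nonneg by simp
  have d_meas [measurable]: "d \<in> borel_measurable M"
    unfolding d_def using u v by measurable
  have d_bound: "\<bar>d x\<bar> \<le> 1" for x
    unfolding d_def by (intro unit_bounds unit_kernel_bound[OF W])
  have g_bound: "\<bar>sqrt (d x)\<bar> \<le> 1" for x
    using d_bound[of x] d_nonneg[of x] by simp
  define V where "V x y = sqrt (d x) * W x y * sqrt (d y)" for x y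
  note b = unit_bounds unit_kernel_bound[OF W] g_bound d_bound
  have V: "unit_kernel M V"
    unfolding unit_kernel_def V_def by (intro conjI allI b) measurable
  have V_sym: "V x y = V y x" for x y
    unfolding V_def using sym[of x y] by simp
  have "edge_codegree M W u v = (\<integral>q. d (fst q) * W (fst q) (snd q) * d (snd q) \<partial>(M \<Otimes>\<^sub>M M))"
    by (simp add: edge_codegree_def d_def)
  also have "\<dots> = (\<integral>x. (\<integral>y. d x * W x y * d y \<partial>M) \<partial>M)"
    by (rule pair_integral_unit_bounded) (auto intro!: b prob_space_axioms)
  also have "\<dots> = (\<integral>x. (\<integral>y. sqrt (d x) * (V x y * sqrt (d y)) \<partial>M) \<partial>M)"
  proof -
    have "d x * W x y * d y = sqrt (d x) * (V x y * sqrt (d y))" for x y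
    proof -
      have "sqrt (d x) * (V x y * sqrt (d y))
          = (sqrt (d x) * sqrt (d x)) * W x y * (sqrt (d y) * sqrt (d y))"
        by (simp only: V_def ac_simps)
      then show ?thesis
        using d_nonneg by simp
    qed
    then show ?thesis
      by simp
  qed
  finally have edge: "edge_codegree M W u v
      = (\<integral>x. sqrt (d x) * (\<integral>y. V x y * sqrt (d y) \<partial>M) \<partial>M)"
    by simp
  have codeg: "codegree M W u v = (\<integral>x. (sqrt (d x))\<^sup>2 \<partial>M)"
    using d_nonneg by (simp add: codegree_def flip: d_def)
  \<comment> \<open>Every rim vertex receives a factor \<open>sqrt (d (x i))\<close> from each of
    its two rim edges; rotating the index merges them into \<open>d (x i)\<close>.\<close>
  have prod_V: "(\<Prod>i<2 * k. V (x i) (x (Suc i mod (2 * k))))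
      = (\<Prod>i<2 * k. W (x i) (x (Suc i mod (2 * k))) * d (x i))" for x :: "nat \<Rightarrow> 'a"
  proof -
    let ?m = "2 * k"
    have "(\<Prod>i<?m. V (x i) (x (Suc i mod ?m))) = (\<Prod>i<?m. W (x i) (x (Suc i mod ?m)))
        * ((\<Prod>i<?m. sqrt (d (x i))) * (\<Prod>i<?m. sqrt (d (x (Suc i mod ?m)))))"
      by (simp add: V_def prod.distrib ac_simps)
    also have "(\<Prod>i<?m. sqrt (d (x (Suc i mod ?m)))) = (\<Prod>i<?m. sqrt (d (x i)))"
      using prod.reindex_bij_betw[OF Suc_mod_bij_betw, of "\<lambda>i. sqrt (d (x i))"] .
    also have "(\<Prod>i<?m. sqrt (d (x i))) * (\<Prod>i<?m. sqrt (d (x i))) = (\<Prod>i<?m. d (x i))"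
      using d_nonneg by (simp flip: prod.distrib)
    finally show ?thesis
      by (simp add: prod.distrib)
  qed
  have "(edge_codegree M W u v / codegree M W u v) ^ (2 * k)
      \<le> (\<integral>x. kernel_power M V (2 * k - 1) x x \<partial>M)"
    unfolding edge codeg
    by (rule Rayleigh_power_le_kernel_power[OF V V_sym _ g_bound assms(3)]) measurable
  also have "\<dots> = (\<integral>x. (\<Prod>i<2 * k. V (x i) (x (Suc i mod (2 * k)))) \<partial>Pi\<^sub>M {0..<2 * k} (\<lambda>_. M))"
    using assms(3) by (intro integral_cycle[OF V V_sym, symmetric]) simp
  also have "\<dots> = cycle_codegree M (2 * k) W u v"
    unfolding prod_V by (simp add: cycle_codegree_def d_def)
  finally show ?thesis .
qed

text \<open>Both sides are the density of \<open>K_4\<close> minus an edge. Once the edge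
  \<open>q\<close> between the rim vertices is fixed, the two apexes decouple and each contributes
  the codegree of the endpoints of \<open>q\<close>.\<close>

lemma integral_edge_codegree:
  "(\<integral>p. edge_codegree M W (fst p) (snd p) \<partial>(M \<Otimes>\<^sub>M M))
   = (\<integral>p. W (fst p) (snd p) * (codegree M W (fst p) (snd p))\<^sup>2 \<partial>(M \<Otimes>\<^sub>M M))"
proof -
  have M: "prob_space M"
    by (rule prob_space_axioms)
  interpret P: prob_space "M \<Otimes>\<^sub>M M"
    by (intro prob_space_pair prob_space_axioms)
  note [measurable] = measurable_unit_kernel[OF W]
  note b = unit_bounds unit_kernel_bound[OF W]
  have "(\<integral>p. edge_codegree M W (fst p) (snd p) \<partial>(M \<Otimes>\<^sub>M M)) =
    (\<integral>q. (\<integral>p. (W (fst p) (fst q) * W (snd p) (fst q)) * W (fst q) (snd q) *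
        (W (fst p) (snd q) * W (snd p) (snd q)) \<partial>(M \<Otimes>\<^sub>M M)) \<partial>(M \<Otimes>\<^sub>M M))"
    unfolding edge_codegree_def
    by (rule Fubini_unit_bounded[OF P.prob_space_axioms P.prob_space_axioms]) (auto intro!: b)
  also have "\<dots> = (\<integral>q. W (fst q) (snd q) * (codegree M W (fst q) (snd q))\<^sup>2 \<partial>(M \<Otimes>\<^sub>M M))"
  proof (rule Bochner_Integration.integral_cong[OF refl])
    fix q assume "q \<in> space (M \<Otimes>\<^sub>M M)"
    then have q: "fst q \<in> space M" "snd q \<in> space M"
      by (auto simp: space_pair_measure)
    let ?h = "\<lambda>x. W (fst q) x * W (snd q) x"
    have "(\<integral>p. (W (fst p) (fst q) * W (snd p) (fst q)) * W (fst q) (snd q) *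
        (W (fst p) (snd q) * W (snd p) (snd q)) \<partial>(M \<Otimes>\<^sub>M M))
      = (\<integral>p. W (fst q) (snd q) * (?h (fst p) * ?h (snd p)) \<partial>(M \<Otimes>\<^sub>M M))"
    proof (rule Bochner_Integration.integral_cong[OF refl])
      fix p :: "'a \<times> 'a"
      show "(W (fst p) (fst q) * W (snd p) (fst q)) * W (fst q) (snd q) *
          (W (fst p) (snd q) * W (snd p) (snd q))
        = W (fst q) (snd q) * (?h (fst p) * ?h (snd p))"
        unfolding sym[of "fst p" "fst q"] sym[of "fst p" "snd q"]
          sym[of "snd p" "fst q"] sym[of "snd p" "snd q"]
        by (simp only: ac_simps)
    qed
    also have "\<dots> = W (fst q) (snd q) * (\<integral>p. ?h (fst p) * ?h (snd p) \<partial>(M \<Otimes>\<^sub>M M))"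
      by simp
    also have "(\<integral>p. ?h (fst p) * ?h (snd p) \<partial>(M \<Otimes>\<^sub>M M)) = (\<integral>x. (\<integral>y. ?h x * ?h y \<partial>M) \<partial>M)"
      by (rule pair_integral_unit_bounded[OF M M]) (use q in \<open>auto intro!: b\<close>)
    also have "\<dots> = (codegree M W (fst q) (snd q))\<^sup>2"
      by (simp add: codegree_def power2_eq_square)
    finally show "(\<integral>p. (W (fst p) (fst q) * W (snd p) (fst q)) * W (fst q) (snd q) *
        (W (fst p) (snd q) * W (snd p) (snd q)) \<partial>(M \<Otimes>\<^sub>M M))
      = W (fst q) (snd q) * (codegree M W (fst q) (snd q))\<^sup>2" .
  qed
  finally show ?thesis .
qed

end

end

section \<open>Scalar inequalities bounding the power of \<open>a / c\<close> from below\<close>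

lemma power_ge_linear_in_square:
  fixes z :: real
  assumes "0 \<le> z" "2 \<le> k"
  shows "1 + real k / 2 * (z\<^sup>2 - 1) \<le> z ^ k"
  using assms(2)
proof (induction k rule: dec_induct)
  case (step k)
  \<comment> \<open>Bernoulli for \<open>z\<^sup>2\<close> with exponent \<open>k / 2\<close>, which
    may be a half-integer, is proved by induction from the equality at \<open>k = 2\<close>. Each
    step loses a multiple of \<open>(z - 1)\<^sup>2\<close> that is nonnegative because
    \<open>k * (z + 1)\<close> is at least 1.\<close>
  have "1 + real (Suc k) / 2 * (z\<^sup>2 - 1)
      = z * (1 + real k / 2 * (z\<^sup>2 - 1)) - (z - 1)\<^sup>2 * (real k * (z + 1) - 1) / 2"
    by (simp add: power2_eq_square field_simps)
  also have "\<dots> \<le> z * (1 + real k / 2 * (z\<^sup>2 - 1))"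
  proof -
    have "1 * 1 \<le> real k * (z + 1)"
      using step.hyps assms(1) by (intro mult_mono) auto
    then show ?thesis
      by simp
  qed
  also have "\<dots> \<le> z * z ^ k"
    using step.IH assms(1) by (rule mult_left_mono)
  finally show ?case
    by simp
qed (simp add: power2_eq_square)

text \<open>For fixed \<open>Y\<close> the left side is a concave quadratic in \<open>X\<close> with
  maximum \<open>(2 * Y - 1)\<^sup>2\<close> at \<open>X = 2 * Y - 1\<close>. The difference of
  squares \<open>Y ^ 4 - (2 * Y - 1)\<^sup>2\<close> factors as
  \<open>(Y - 1)\<^sup>2 * (Y\<^sup>2 + 2 * Y - 1)\<close>, nonnegative for \<open>Y\<close> above
  1/2; below that the left side is not positive.\<close>

lemma product_le_quartic:
  fixes X Y :: real
  assumes "0 \<le> X" "0 \<le> Y"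
  shows "4 * X * Y - 2 * X - X\<^sup>2 \<le> Y ^ 4"
proof (cases "2 * Y \<le> 1")
  case True
  then have "2 * X * (2 * Y) \<le> 2 * X * 1"
    using assms by (intro mult_left_mono) auto
  then have "4 * X * Y \<le> 2 * X"
    by simp
  moreover have "0 \<le> X\<^sup>2" "0 \<le> Y ^ 4"
    by simp_all
  ultimately show ?thesis
    by linarith
next
  case False
  have "Y ^ 4 - (4 * X * Y - 2 * X - X\<^sup>2) = (X - (2 * Y - 1))\<^sup>2 + (Y - 1)\<^sup>2 * (Y\<^sup>2 + 2 * Y - 1)"
    by (simp add: power2_eq_square power4_eq_xxxx algebra_simps)
  moreover have "0 \<le> (X - (2 * Y - 1))\<^sup>2 + (Y - 1)\<^sup>2 * (Y\<^sup>2 + 2 * Y - 1)"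
    using False by (intro add_nonneg_nonneg mult_nonneg_nonneg) (auto intro: add_increasing)
  ultimately show ?thesis
    by linarith
qed

text \<open>The constants normalise the case \<open>W = 1/2\<close>, where \<open>c = 1/4\<close>
  and \<open>a = 1/32\<close>. Bernoulli is applied to \<open>z = Y\<^sup>2\<close>, whose square is
  the quartic bounded in \<open>product_le_quartic\<close>.\<close>

lemma ratio_power_ge:
  fixes a c :: real
  assumes "0 \<le> a" "0 \<le> c" "c = 0 \<Longrightarrow> a = 0" "2 \<le> k"
  shows "1 + real k / 2 * (128 * a - 8 * c - 16 * c\<^sup>2 - 1) \<le> 64 ^ k * (a / c) ^ (2 * k)"
proof -
  define Y where "Y = 8 * (a / c)"
  have "4 * (4 * c) * Y - 2 * (4 * c) - (4 * c)\<^sup>2 \<le> Y ^ 4"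
    using assms by (intro product_le_quartic) (auto simp: Y_def)
  moreover have "c * Y = 8 * a"
    using assms(3) by (auto simp: Y_def)
  ultimately have "128 * a - 8 * c - 16 * c\<^sup>2 - 1 \<le> (Y\<^sup>2)\<^sup>2 - 1"
    by (simp add: power2_eq_square power4_eq_xxxx algebra_simps)
  then have "1 + real k / 2 * (128 * a - 8 * c - 16 * c\<^sup>2 - 1) \<le> 1 + real k / 2 * ((Y\<^sup>2)\<^sup>2 - 1)"
    by (intro add_left_mono mult_left_mono) auto
  also have "\<dots> \<le> (Y\<^sup>2) ^ k"
    using assms(4) by (intro power_ge_linear_in_square) auto
  also have "\<dots> = 64 ^ k * (a / c) ^ (2 * k)"
    unfolding Y_def power_mult power_mult_distrib by simp
  finally show ?thesis .
qed

section \<open>Averaging over the two apexes and adding the complement\<close>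

context prob_space
begin

lemma unit_kernel_codegree:
  assumes W: "unit_kernel M W"
  shows "unit_kernel M (codegree M W)"
proof -
  note [measurable] = measurable_unit_kernel[OF W]
  show ?thesis
    unfolding unit_kernel_def codegree_def
    by (auto intro!: abs_integral_le_1 unit_bounds unit_kernel_bound[OF W])
qed

lemma unit_kernel_edge_codegree:
  assumes W: "unit_kernel M W"
  shows "unit_kernel M (edge_codegree M W)"
proof -
  interpret P: prob_space "M \<Otimes>\<^sub>M M"
    by (intro prob_space_pair prob_space_axioms)
  note [measurable] = measurable_unit_kernel[OF W]
  show ?thesis
    unfolding unit_kernel_def edge_codegree_def
    by (auto intro!: P.abs_integral_le_1 unit_bounds unit_kernel_bound[OF W])
qed

lemma unit_kernel_cycle_codegree:
  assumes W: "unit_kernel M W"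
  shows "unit_kernel M (cycle_codegree M m W)"
proof -
  interpret I: prob_space "Pi\<^sub>M {0..<m} (\<lambda>_. M)"
    by (intro prob_space_PiM prob_space_axioms)
  note [measurable] = measurable_unit_kernel[OF W]
  have "(\<lambda>z. W (fst (fst z)) (snd z i)) \<in> borel_measurable ((M \<Otimes>\<^sub>M M) \<Otimes>\<^sub>M Pi\<^sub>M {0..<m} (\<lambda>_. M))"
    "(\<lambda>z. W (snd (fst z)) (snd z i)) \<in> borel_measurable ((M \<Otimes>\<^sub>M M) \<Otimes>\<^sub>M Pi\<^sub>M {0..<m} (\<lambda>_. M))"
    "(\<lambda>z. W (snd z i) (snd z (Suc i mod m)))
      \<in> borel_measurable ((M \<Otimes>\<^sub>M M) \<Otimes>\<^sub>M Pi\<^sub>M {0..<m} (\<lambda>_. M))"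
    if "i < m" for i
  proof -
    \<comment> \<open>Coordinate projections are measurable only at indices of the product,
      including the wrapped successor.\<close>
    have [measurable]: "i \<in> {0..<m}" "Suc i mod m \<in> {0..<m}"
      using that by auto
    show "(\<lambda>z. W (fst (fst z)) (snd z i)) \<in> borel_measurable ((M \<Otimes>\<^sub>M M) \<Otimes>\<^sub>M Pi\<^sub>M {0..<m} (\<lambda>_. M))"
      "(\<lambda>z. W (snd (fst z)) (snd z i)) \<in> borel_measurable ((M \<Otimes>\<^sub>M M) \<Otimes>\<^sub>M Pi\<^sub>M {0..<m} (\<lambda>_. M))"
      "(\<lambda>z. W (snd z i) (snd z (Suc i mod m)))
        \<in> borel_measurable ((M \<Otimes>\<^sub>M M) \<Otimes>\<^sub>M Pi\<^sub>M {0..<m} (\<lambda>_. M))"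
      by measurable
  qed
  then have [measurable]: "(\<lambda>z. \<Prod>i<m. W (snd z i) (snd z (Suc i mod m)) *
      (W (fst (fst z)) (snd z i) * W (snd (fst z)) (snd z i)))
    \<in> borel_measurable ((M \<Otimes>\<^sub>M M) \<Otimes>\<^sub>M Pi\<^sub>M {0..<m} (\<lambda>_. M))"
    by (intro borel_measurable_prod borel_measurable_times) auto
  have "(\<lambda>p. cycle_codegree M m W (fst p) (snd p)) \<in> borel_measurable (M \<Otimes>\<^sub>M M)"
    unfolding cycle_codegree_def
    by (rule I.borel_measurable_lebesgue_integral) (simp add: case_prod_beta')
  then show ?thesis
    unfolding unit_kernel_def case_prod_beta'
    unfolding cycle_codegree_def
    by (auto intro!: I.abs_integral_le_1 unit_bounds unit_kernel_bound[OF W])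
qed

context
  fixes W :: "'a \<Rightarrow> 'a \<Rightarrow> real"
  assumes W: "unit_kernel M W" and sym: "\<And>x y. W x y = W y x" and nonneg: "\<And>x y. 0 \<le> W x y"
begin

text \<open>The pointwise bound is linear in \<open>a\<close>, so after averaging \<open>a\<close>
  may be exchanged for \<open>W\<close> times the squared codegree, although the two differ
  pointwise.\<close>

lemma integral_cycle_codegree_ge:
  assumes "2 \<le> k"
  shows "1 + real k / 2 * (\<integral>p. 128 * (W (fst p) (snd p) * (codegree M W (fst p) (snd p))\<^sup>2)
      - 8 * codegree M W (fst p) (snd p) - 16 * (codegree M W (fst p) (snd p))\<^sup>2 - 1 \<partial>(M \<Otimes>\<^sub>M M))
    \<le> 64 ^ k * (\<integral>p. cycle_codegree M (2 * k) W (fst p) (snd p) \<partial>(M \<Otimes>\<^sub>M M))"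
proof -
  interpret P: prob_space "M \<Otimes>\<^sub>M M"
    by (intro prob_space_pair prob_space_axioms)
  note C = unit_kernel_codegree[OF W] and E = unit_kernel_edge_codegree[OF W]
    and B = unit_kernel_cycle_codegree[OF W, of "2 * k"]
  note [measurable] = measurable_unit_kernel[OF W] measurable_unit_kernel[OF C]
    measurable_unit_kernel[OF E] measurable_unit_kernel[OF B]
  note b = unit_bounds unit_kernel_bound[OF W] unit_kernel_bound[OF C] unit_kernel_bound[OF E]
    unit_kernel_bound[OF B]
  let ?c = "\<lambda>p. codegree M W (fst p) (snd p)" and ?e = "\<lambda>p. edge_codegree M W (fst p) (snd p)"
    and ?b = "\<lambda>p. cycle_codegree M (2 * k) W (fst p) (snd p)"
  have int: "integrable (M \<Otimes>\<^sub>M M) ?c" "integrable (M \<Otimes>\<^sub>M M) (\<lambda>p. (?c p)\<^sup>2)"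
    "integrable (M \<Otimes>\<^sub>M M) ?e" "integrable (M \<Otimes>\<^sub>M M) ?b"
    "integrable (M \<Otimes>\<^sub>M M) (\<lambda>p. W (fst p) (snd p) * (?c p)\<^sup>2)"
    by (intro P.integrable_unit_bounded b; measurable)+
  have "1 + real k / 2 * (\<integral>p. 128 * (W (fst p) (snd p) * (?c p)\<^sup>2) - 8 * ?c p - 16 * (?c p)\<^sup>2 - 1
      \<partial>(M \<Otimes>\<^sub>M M))
    = (\<integral>p. 1 + real k / 2 * (128 * ?e p - 8 * ?c p - 16 * (?c p)\<^sup>2 - 1) \<partial>(M \<Otimes>\<^sub>M M))"
    using int integral_edge_codegree[OF W sym nonneg] by (simp add: P.prob_space)
  also have "\<dots> \<le> (\<integral>p. 64 ^ k * ?b p \<partial>(M \<Otimes>\<^sub>M M))"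
  proof (rule integral_mono)
    fix p assume "p \<in> space (M \<Otimes>\<^sub>M M)"
    then have p: "fst p \<in> space M" "snd p \<in> space M"
      by (auto simp: space_pair_measure)
    have "1 + real k / 2 * (128 * ?e p - 8 * ?c p - 16 * (?c p)\<^sup>2 - 1) \<le> 64 ^ k * (?e p / ?c p) ^ (2 * k)"
    proof (rule ratio_power_ge[OF _ _ _ assms])
      show "0 \<le> ?e p" "0 \<le> ?c p"
        unfolding edge_codegree_def codegree_def using nonneg by simp_all
      show "?e p = 0" if "?c p = 0"
        using edge_codegree_eq_0[OF W sym nonneg p that] .
    qed
    also have "\<dots> \<le> 64 ^ k * ?b p"
      using ratio_power_le_cycle_codegree[OF W sym nonneg p, of k] assms by simp
    finally show "1 + real k / 2 * (128 * ?e p - 8 * ?c p - 16 * (?c p)\<^sup>2 - 1) \<le> 64 ^ k * ?b p" .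
  qed (intro Bochner_Integration.integrable_add Bochner_Integration.integrable_diff
      integrable_mult_right P.integrable_const int)+
  finally show ?thesis
    by simp
qed

end

text \<open>The remaining cross term \<open>16 f n s\<close> with \<open>s = \<epsilon>(x) + \<epsilon>(y)\<close> is absorbed by the square
  \<open>6 (n + 4/3 f s)^2\<close>; all other terms integrate to multiples of \<open>\<kappa> = \<integral>\<epsilon>^2\<close>.\<close>

lemma Goodman_type_inequality:
  fixes W :: "'a \<Rightarrow> 'a \<Rightarrow> real"
  assumes W: "unit_kernel M W" and sym: "\<And>x y. W x y = W y x" and nonneg: "\<And>x y. 0 \<le> W x y"
  defines "W' \<equiv> \<lambda>x y. 1 - W x y"
  shows "0 \<le> (\<integral>p. 128 * (W (fst p) (snd p) * (codegree M W (fst p) (snd p))\<^sup>2)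
      - 8 * codegree M W (fst p) (snd p) - 16 * (codegree M W (fst p) (snd p))\<^sup>2 - 1 \<partial>(M \<Otimes>\<^sub>M M))
    + (\<integral>p. 128 * (W' (fst p) (snd p) * (codegree M W' (fst p) (snd p))\<^sup>2)
      - 8 * codegree M W' (fst p) (snd p) - 16 * (codegree M W' (fst p) (snd p))\<^sup>2 - 1 \<partial>(M \<Otimes>\<^sub>M M))"
proof -
  have M: "prob_space M"
    by (rule prob_space_axioms)
  interpret P: prob_space "M \<Otimes>\<^sub>M M"
    by (intro prob_space_pair prob_space_axioms)
  \<comment> \<open>Passing from \<open>W\<close> to \<open>W'\<close> negates \<open>f\<close> and
    \<open>\<epsilon>\<close> and fixes \<open>n\<close>, so only terms even under this sign change
    survive in the sum.\<close>
  define f where "f x y = 2 * W x y - 1" for x y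
  define \<epsilon> where "\<epsilon> x = (\<integral>y. f x y \<partial>M)" for x
  define n where "n x y = (\<integral>z. f x z * f y z \<partial>M)" for x y
  define \<kappa> where "\<kappa> = (\<integral>x. (\<epsilon> x)\<^sup>2 \<partial>M)"
  have le1: "W x y \<le> 1" for x y
    using unit_kernel_bound[OF W, of x y] by simp
  note [measurable] = measurable_unit_kernel[OF W]
  have W': "unit_kernel M W'"
    unfolding unit_kernel_def W'_def using le1 nonneg by auto
  have f: "unit_kernel M f"
    unfolding unit_kernel_def f_def using le1 nonneg by (auto simp: abs_le_iff)
  have f_sym: "f x y = f y x" for x y
    unfolding f_def using sym[of x y] by simp
  note [measurable] = measurable_unit_kernel[OF W'] measurable_unit_kernel[OF f]
  have [measurable]: "\<epsilon> \<in> borel_measurable M"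
    unfolding \<epsilon>_def by measurable
  have n: "unit_kernel M n"
    unfolding unit_kernel_def n_def
    by (auto intro!: abs_integral_le_1 unit_bounds unit_kernel_bound[OF f])
  have \<epsilon>_bound: "\<bar>\<epsilon> x\<bar> \<le> 1" for x
    unfolding \<epsilon>_def by (intro abs_integral_le_1 unit_kernel_bound[OF f])
  note C = unit_kernel_codegree[OF W] and C' = unit_kernel_codegree[OF W']
  note [measurable] = measurable_unit_kernel[OF n] measurable_unit_kernel[OF C] measurable_unit_kernel[OF C']
  note b = unit_bounds \<epsilon>_bound unit_kernel_bound[OF W] unit_kernel_bound[OF W']
    unit_kernel_bound[OF f] unit_kernel_bound[OF n] unit_kernel_bound[OF C] unit_kernel_bound[OF C']
  have codeg: "codegree M W u v = (1 + n u v + (\<epsilon> u + \<epsilon> v)) / 4"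
    and codeg': "codegree M W' u v = (1 + n u v - (\<epsilon> u + \<epsilon> v)) / 4"
    if u: "u \<in> space M" and v: "v \<in> space M" for u v
  proof -
    have int: "integrable M (\<lambda>x. f u x)" "integrable M (\<lambda>x. f v x)" "integrable M (\<lambda>x. f u x * f v x)"
      using u v by (intro integrable_unit_bounded b; measurable)+
    have "codegree M W u v = (\<integral>x. (1 + f u x * f v x + (f u x + f v x)) / 4 \<partial>M)"
      unfolding codegree_def
      by (intro Bochner_Integration.integral_cong) (auto simp: f_def field_simps)
    also have "\<dots> = (1 + n u v + (\<epsilon> u + \<epsilon> v)) / 4"
      using int by (simp add: n_def \<epsilon>_def prob_space)
    finally show "codegree M W u v = (1 + n u v + (\<epsilon> u + \<epsilon> v)) / 4" .
    have "codegree M W' u v = (\<integral>x. (1 + f u x * f v x - (f u x + f v x)) / 4 \<partial>M)"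
      unfolding codegree_def
      by (intro Bochner_Integration.integral_cong) (auto simp: f_def W'_def field_simps)
    also have "\<dots> = (1 + n u v - (\<epsilon> u + \<epsilon> v)) / 4"
      using int by (simp add: n_def \<epsilon>_def prob_space)
    finally show "codegree M W' u v = (1 + n u v - (\<epsilon> u + \<epsilon> v)) / 4" .
  qed
  have int: "integrable (M \<Otimes>\<^sub>M M) (\<lambda>p. codegree M W (fst p) (snd p))"
    "integrable (M \<Otimes>\<^sub>M M) (\<lambda>p. (codegree M W (fst p) (snd p))\<^sup>2)"
    "integrable (M \<Otimes>\<^sub>M M) (\<lambda>p. W (fst p) (snd p) * (codegree M W (fst p) (snd p))\<^sup>2)"
    "integrable (M \<Otimes>\<^sub>M M) (\<lambda>p. codegree M W' (fst p) (snd p))"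
    "integrable (M \<Otimes>\<^sub>M M) (\<lambda>p. (codegree M W' (fst p) (snd p))\<^sup>2)"
    "integrable (M \<Otimes>\<^sub>M M) (\<lambda>p. W' (fst p) (snd p) * (codegree M W' (fst p) (snd p))\<^sup>2)"
    "integrable (M \<Otimes>\<^sub>M M) (\<lambda>p. n (fst p) (snd p))"
    "integrable (M \<Otimes>\<^sub>M M) (\<lambda>p. f (fst p) (snd p) * \<epsilon> (fst p))"
    "integrable (M \<Otimes>\<^sub>M M) (\<lambda>p. f (fst p) (snd p) * \<epsilon> (snd p))"
    "integrable (M \<Otimes>\<^sub>M M) (\<lambda>p. (\<epsilon> (fst p))\<^sup>2)" "integrable (M \<Otimes>\<^sub>M M) (\<lambda>p. (\<epsilon> (snd p))\<^sup>2)"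
    by (intro P.integrable_unit_bounded b; measurable)+
  have I1: "(\<integral>p. n (fst p) (snd p) \<partial>(M \<Otimes>\<^sub>M M)) = \<kappa>"
  proof -
    have "(\<integral>p. n (fst p) (snd p) \<partial>(M \<Otimes>\<^sub>M M))
        = (\<integral>z. (\<integral>p. f (fst p) z * f (snd p) z \<partial>(M \<Otimes>\<^sub>M M)) \<partial>M)"
      unfolding n_def by (rule Fubini_unit_bounded[OF P.prob_space_axioms M]) (auto intro!: b)
    also have "\<dots> = (\<integral>z. (\<epsilon> z)\<^sup>2 \<partial>M)"
    proof (rule Bochner_Integration.integral_cong[OF refl])
      fix z assume z: "z \<in> space M"
      have "(\<integral>p. f (fst p) z * f (snd p) z \<partial>(M \<Otimes>\<^sub>M M)) = (\<integral>x. (\<integral>y. f x z * f y z \<partial>M) \<partial>M)"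
        by (rule pair_integral_unit_bounded[OF M M]) (use z in \<open>auto intro!: b\<close>)
      then show "(\<integral>p. f (fst p) z * f (snd p) z \<partial>(M \<Otimes>\<^sub>M M)) = (\<epsilon> z)\<^sup>2"
        unfolding \<epsilon>_def f_sym[of z] by (simp add: power2_eq_square)
    qed
    finally show ?thesis
      by (simp add: \<kappa>_def)
  qed
  have I2: "(\<integral>p. f (fst p) (snd p) * \<epsilon> (fst p) \<partial>(M \<Otimes>\<^sub>M M)) = \<kappa>"
  proof -
    have "(\<integral>p. f (fst p) (snd p) * \<epsilon> (fst p) \<partial>(M \<Otimes>\<^sub>M M)) = (\<integral>x. (\<integral>y. f x y * \<epsilon> x \<partial>M) \<partial>M)"
      by (rule pair_integral_unit_bounded[OF M M]) (auto intro!: b)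
    also have "\<dots> = \<kappa>"
      by (simp add: \<kappa>_def power2_eq_square flip: \<epsilon>_def)
    finally show ?thesis .
  qed
  have I3: "(\<integral>p. f (fst p) (snd p) * \<epsilon> (snd p) \<partial>(M \<Otimes>\<^sub>M M)) = \<kappa>"
  proof -
    have "(\<integral>p. f (fst p) (snd p) * \<epsilon> (snd p) \<partial>(M \<Otimes>\<^sub>M M)) = (\<integral>x. (\<integral>y. f x y * \<epsilon> y \<partial>M) \<partial>M)"
      by (rule pair_integral_unit_bounded[OF M M]) (auto intro!: b)
    also have "\<dots> = (\<integral>y. (\<integral>x. f x y * \<epsilon> y \<partial>M) \<partial>M)"
      by (rule Fubini_unit_bounded[OF M M]) (auto intro!: b)
    also have "\<dots> = (\<integral>y. (\<integral>x. f y x * \<epsilon> y \<partial>M) \<partial>M)"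
      by (subst f_sym) (rule refl)
    also have "\<dots> = \<kappa>"
      by (simp add: \<kappa>_def power2_eq_square flip: \<epsilon>_def)
    finally show ?thesis .
  qed
  have I4: "(\<integral>p. (\<epsilon> (fst p))\<^sup>2 \<partial>(M \<Otimes>\<^sub>M M)) = \<kappa>"
  proof -
    have "(\<integral>p. (\<epsilon> (fst p))\<^sup>2 \<partial>(M \<Otimes>\<^sub>M M)) = (\<integral>x. (\<integral>y. (\<epsilon> x)\<^sup>2 \<partial>M) \<partial>M)"
      by (rule pair_integral_unit_bounded[OF M M]) (measurable, intro b)
    then show ?thesis
      by (simp add: \<kappa>_def prob_space)
  qed
  have I5: "(\<integral>p. (\<epsilon> (snd p))\<^sup>2 \<partial>(M \<Otimes>\<^sub>M M)) = \<kappa>"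
  proof -
    have "(\<integral>p. (\<epsilon> (snd p))\<^sup>2 \<partial>(M \<Otimes>\<^sub>M M)) = (\<integral>x. (\<integral>y. (\<epsilon> y)\<^sup>2 \<partial>M) \<partial>M)"
      by (rule pair_integral_unit_bounded[OF M M]) (measurable, intro b)
    then show ?thesis
      by (simp add: \<kappa>_def prob_space)
  qed
  have "0 \<le> \<kappa>"
    by (simp add: \<kappa>_def)
  \<comment> \<open>The total coefficient of \<open>\<kappa>\<close> is
    \<open>8 + 32 - 56/3 = 64/3\<close>.\<close>
  then have "0 \<le> 8 * \<kappa> + 16 * (\<kappa> + \<kappa>) - 28 / 3 * (\<kappa> + \<kappa>)"
    by simp
  also have "\<dots> = (\<integral>p. 8 * n (fst p) (snd p)
      + 16 * (f (fst p) (snd p) * \<epsilon> (fst p) + f (fst p) (snd p) * \<epsilon> (snd p))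
      - 28 / 3 * ((\<epsilon> (fst p))\<^sup>2 + (\<epsilon> (snd p))\<^sup>2) \<partial>(M \<Otimes>\<^sub>M M))"
    using int by (simp add: I1 I2 I3 I4 I5)
  also have "\<dots> \<le> (\<integral>p. (128 * (W (fst p) (snd p) * (codegree M W (fst p) (snd p))\<^sup>2)
      - 8 * codegree M W (fst p) (snd p) - 16 * (codegree M W (fst p) (snd p))\<^sup>2 - 1)
    + (128 * (W' (fst p) (snd p) * (codegree M W' (fst p) (snd p))\<^sup>2)
      - 8 * codegree M W' (fst p) (snd p) - 16 * (codegree M W' (fst p) (snd p))\<^sup>2 - 1) \<partial>(M \<Otimes>\<^sub>M M))"
  proof (rule integral_mono)
    fix p assume "p \<in> space (M \<Otimes>\<^sub>M M)"
    then have p: "fst p \<in> space M" "snd p \<in> space M"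
      by (auto simp: space_pair_measure)
    define F N a c where "F = f (fst p) (snd p)" and "N = n (fst p) (snd p)"
      and "a = \<epsilon> (fst p)" and "c = \<epsilon> (snd p)"
    have W_eq: "W (fst p) (snd p) = (1 + F) / 2" "W' (fst p) (snd p) = (1 - F) / 2"
      by (auto simp: F_def f_def W'_def)
    have "F\<^sup>2 \<le> 1"
      unfolding F_def using unit_kernel_bound[OF f] by (simp add: abs_square_le_1)
    \<comment> \<open>With \<open>s = a + c\<close> the right side below expands to
      \<open>8 N + 6 N^2 + 6 s^2 + 16 F s + 16 F N s\<close>. Completing the square costs
      \<open>32/3 F^2 s^2\<close>, at most \<open>32/3 s^2\<close>, which leaves
      \<open>-14/3 s^2\<close>. The square of \<open>a - c\<close> then trades \<open>s^2\<close>
      for \<open>2 (a^2 + c^2)\<close>, whose integral is a multiple of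
      \<open>\<kappa>\<close>.\<close>
    then have "32 / 3 * (F\<^sup>2 * (a + c)\<^sup>2) \<le> 32 / 3 * (1 * (a + c)\<^sup>2)"
      by (intro mult_left_mono mult_right_mono) auto
    moreover have "0 \<le> 6 * (N + 4 / 3 * F * (a + c))\<^sup>2"
      by simp
    moreover have "0 \<le> 14 / 3 * (a - c)\<^sup>2"
      by simp
    ultimately have "8 * N + 16 * (F * a + F * c) - 28 / 3 * (a\<^sup>2 + c\<^sup>2)
      \<le> (128 * ((1 + F) / 2 * ((1 + N + (a + c)) / 4)\<^sup>2) - 8 * ((1 + N + (a + c)) / 4)
          - 16 * ((1 + N + (a + c)) / 4)\<^sup>2 - 1)
        + (128 * ((1 - F) / 2 * ((1 + N - (a + c)) / 4)\<^sup>2) - 8 * ((1 + N - (a + c)) / 4)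
          - 16 * ((1 + N - (a + c)) / 4)\<^sup>2 - 1)"
      by (simp add: power2_eq_square algebra_simps add_divide_distrib diff_divide_distrib)
    then show "8 * n (fst p) (snd p)
        + 16 * (f (fst p) (snd p) * \<epsilon> (fst p) + f (fst p) (snd p) * \<epsilon> (snd p))
        - 28 / 3 * ((\<epsilon> (fst p))\<^sup>2 + (\<epsilon> (snd p))\<^sup>2)
      \<le> (128 * (W (fst p) (snd p) * (codegree M W (fst p) (snd p))\<^sup>2)
        - 8 * codegree M W (fst p) (snd p) - 16 * (codegree M W (fst p) (snd p))\<^sup>2 - 1)
      + (128 * (W' (fst p) (snd p) * (codegree M W' (fst p) (snd p))\<^sup>2)
        - 8 * codegree M W' (fst p) (snd p) - 16 * (codegree M W' (fst p) (snd p))\<^sup>2 - 1)"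
      unfolding codeg[OF p] codeg'[OF p] W_eq F_def N_def a_def c_def .
  qed (intro Bochner_Integration.integrable_add Bochner_Integration.integrable_diff
      integrable_mult_right P.integrable_const int)+
  also have "\<dots> = (\<integral>p. 128 * (W (fst p) (snd p) * (codegree M W (fst p) (snd p))\<^sup>2)
      - 8 * codegree M W (fst p) (snd p) - 16 * (codegree M W (fst p) (snd p))\<^sup>2 - 1 \<partial>(M \<Otimes>\<^sub>M M))
    + (\<integral>p. 128 * (W' (fst p) (snd p) * (codegree M W' (fst p) (snd p))\<^sup>2)
      - 8 * codegree M W' (fst p) (snd p) - 16 * (codegree M W' (fst p) (snd p))\<^sup>2 - 1 \<partial>(M \<Otimes>\<^sub>M M))"
    by (intro Bochner_Integration.integral_add Bochner_Integration.integrable_diff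
      integrable_mult_right P.integrable_const int)
  finally show ?thesis .
qed

text \<open>Adding the bounds for \<open>W\<close> and its complement, the two constants 1 give the
  2 and the remaining integrals have nonnegative sum.\<close>

lemma cycle_codegree_sum_ge:
  fixes W :: "'a \<Rightarrow> 'a \<Rightarrow> real"
  assumes W: "unit_kernel M W" and sym: "\<And>x y. W x y = W y x" and nonneg: "\<And>x y. 0 \<le> W x y"
    and k: "2 \<le> k"
  shows "2 \<le> 64 ^ k * ((\<integral>p. cycle_codegree M (2 * k) W (fst p) (snd p) \<partial>(M \<Otimes>\<^sub>M M))
    + (\<integral>p. cycle_codegree M (2 * k) (\<lambda>x y. 1 - W x y) (fst p) (snd p) \<partial>(M \<Otimes>\<^sub>M M)))"
proof -
  have le1: "W x y \<le> 1" for x y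
    using unit_kernel_bound[OF W, of x y] by simp
  note [measurable] = measurable_unit_kernel[OF W]
  have W': "unit_kernel M (\<lambda>x y. 1 - W x y)"
    unfolding unit_kernel_def using le1 nonneg by auto
  have sym': "1 - W x y = 1 - W y x" for x y
    using sym[of x y] by simp
  have "0 \<le> real k / 2"
    by simp
  note mult_nonneg_nonneg[OF this Goodman_type_inequality[OF W sym nonneg]]
  moreover note integral_cycle_codegree_ge[OF W sym nonneg k]
  moreover have "0 \<le> 1 - W x y" for x y
    using le1[of x y] by simp
  note integral_cycle_codegree_ge[OF W' sym' this k]
  ultimately show ?thesis
    by (simp only: distrib_left)
qed

text \<open>The apexes occupy the coordinates \<open>m\<close> and \<open>Suc m\<close>. Both are
  split off the product measure and moved outside by Fubini.\<close>

lemma integral_two_apexes: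
  fixes W :: "'a \<Rightarrow> 'a \<Rightarrow> real"
  assumes W: "unit_kernel M W"
  shows "(\<integral>x. (\<Prod>i<m. W (x i) (x (Suc i mod m)) * (W (x (Suc m)) (x i) * W (x m) (x i)))
      \<partial>Pi\<^sub>M {0..<m + 2} (\<lambda>_. M))
    = (\<integral>p. cycle_codegree M m W (fst p) (snd p) \<partial>(M \<Otimes>\<^sub>M M))"
proof -
  interpret product_sigma_finite "\<lambda>_::nat. M" ..
  let ?P = "\<lambda>n. Pi\<^sub>M {0..<n::nat} (\<lambda>_. M)"
  have P: "prob_space (?P n)" for n
    by (intro prob_space_PiM prob_space_axioms)
  have M: "prob_space M"
    by (rule prob_space_axioms)
  note [measurable] = measurable_unit_kernel[OF W]
  note b = unit_bounds unit_kernel_bound[OF W]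
  define H where "H v u x = (\<Prod>i<m. W (x i) (x (Suc i mod m)) * (W v (x i) * W u (x i)))"
    for v u :: 'a and x :: "nat \<Rightarrow> 'a"
  have H_bound: "\<bar>H v u x\<bar> \<le> 1" for v u x
    unfolding H_def by (intro b)
  have meas: "(\<lambda>z. H (v z) (u z) (x z)) \<in> borel_measurable N"
    if [measurable]: "v \<in> measurable N M" "u \<in> measurable N M"
      and x: "\<And>i. i < m \<Longrightarrow> (\<lambda>z. x z i) \<in> measurable N M" for v u x N
    unfolding H_def
  proof (intro borel_measurable_prod borel_measurable_times)
    fix i assume "i \<in> {..<m}"
    then have [measurable]: "(\<lambda>z. x z i) \<in> measurable N M" "(\<lambda>z. x z (Suc i mod m)) \<in> measurable N M"
      by (auto intro!: x)
    show "(\<lambda>z. W (x z i) (x z (Suc i mod m))) \<in> borel_measurable N"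
      "(\<lambda>z. W (v z) (x z i)) \<in> borel_measurable N" "(\<lambda>z. W (u z) (x z i)) \<in> borel_measurable N"
      by measurable
  qed
  have insert2: "{0..<m + 2} = insert (Suc m) {0..<Suc m}" and insert1: "{0..<Suc m} = insert m {0..<m}"
    by auto
  \<comment> \<open>\<open>H\<close> takes the apexes as separate arguments and reads only rim
    coordinates of \<open>x\<close>, so it does not see updates at apex positions.\<close>
  have H_upd: "H v u (x(j := y)) = H v u x" if "m \<le> j" for v u x y j
    unfolding H_def
  proof (intro prod.cong refl)
    fix i assume "i \<in> {..<m}"
    then have "i \<noteq> j" "Suc i mod m \<noteq> j"
      using that mod_less_divisor[of m "Suc i"] by (auto simp del: mod_less_divisor)
    then show "W ((x(j := y)) i) ((x(j := y)) (Suc i mod m))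
        * (W v ((x(j := y)) i) * W u ((x(j := y)) i))
      = W (x i) (x (Suc i mod m)) * (W v (x i) * W u (x i))"
      by simp
  qed
  have int2: "integrable (Pi\<^sub>M (insert (Suc m) {0..<Suc m}) (\<lambda>_. M)) (\<lambda>x. H (x (Suc m)) (x m) x)"
    unfolding insert2[symmetric]
    by (intro prob_space.integrable_unit_bounded[OF P] H_bound meas measurable_component_singleton) auto
  have int1: "integrable (Pi\<^sub>M (insert m {0..<m}) (\<lambda>_. M)) (\<lambda>x. H v (x m) x)"
    if "v \<in> space M" for v
    unfolding insert1[symmetric] using that
    by (intro prob_space.integrable_unit_bounded[OF P] H_bound meas measurable_component_singleton) auto
  have "(\<integral>x. H (x (Suc m)) (x m) x \<partial>?P (m + 2)) = (\<integral>x. (\<integral>v. H v (x m) x \<partial>M) \<partial>?P (Suc m))"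
    unfolding insert2 by (subst product_integral_insert[OF _ _ int2]) (simp_all add: H_upd)
  also have "\<dots> = (\<integral>v. (\<integral>x. H v (x m) x \<partial>?P (Suc m)) \<partial>M)"
    by (intro Fubini_unit_bounded[OF P M] H_bound) (auto simp: case_prod_beta' intro!: meas)
  also have "\<dots> = (\<integral>v. (\<integral>x. (\<integral>u. H v u x \<partial>M) \<partial>?P m) \<partial>M)"
  proof (rule Bochner_Integration.integral_cong[OF refl])
    fix v assume "v \<in> space M"
    then show "(\<integral>x. H v (x m) x \<partial>?P (Suc m)) = (\<integral>x. (\<integral>u. H v u x \<partial>M) \<partial>?P m)"
      unfolding insert1 by (subst product_integral_insert[OF _ _ int1]) (simp_all add: H_upd)
  qed
  also have "\<dots> = (\<integral>v. (\<integral>u. (\<integral>x. H v u x \<partial>?P m) \<partial>M) \<partial>M)"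
  proof (rule Bochner_Integration.integral_cong[OF refl])
    fix v assume "v \<in> space M"
    then show "(\<integral>x. (\<integral>u. H v u x \<partial>M) \<partial>?P m) = (\<integral>u. (\<integral>x. H v u x \<partial>?P m) \<partial>M)"
      by (intro Fubini_unit_bounded[OF P M] H_bound) (auto simp: case_prod_beta' intro!: meas)
  qed
  also have "\<dots> = (\<integral>v. (\<integral>u. cycle_codegree M m W v u \<partial>M) \<partial>M)"
    by (simp only: cycle_codegree_def H_def)
  also have "\<dots> = (\<integral>p. cycle_codegree M m W (fst p) (snd p) \<partial>(M \<Otimes>\<^sub>M M))"
    using unit_kernel_cycle_codegree[OF W]
    by (intro pair_integral_unit_bounded[OF M M, symmetric]) (auto simp: unit_kernel_def)
  finally show ?thesis
    by (simp only: H_def)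
qed

end

subsection \<open>Beachball graphs\<close>

text \<open>The bound on \<open>m\<close> keeps the rim a genuine cycle: for \<open>m = 2\<close>
  the indices 0 and 1 would give the same rim edge.\<close>

lemma beachball_E_decomp:
  fixes m :: nat
  assumes "3 \<le> m"
  defines "R \<equiv> (\<lambda>i. {i, Suc i mod m}) ` {..<m}"
    and "A \<equiv> (\<lambda>i. {i, m}) ` {..<m}" and "B \<equiv> (\<lambda>i. {i, Suc m}) ` {..<m}"
  shows "beachball_E m = R \<union> A \<union> B" "R \<inter> A = {}" "(R \<union> A) \<inter> B = {}"
    "inj_on (\<lambda>i. {i, Suc i mod m}) {..<m}" "inj_on (\<lambda>i. {i, m}) {..<m}"
    "inj_on (\<lambda>i. {i, Suc m}) {..<m}"
proof -
  show "beachball_E m = R \<union> A \<union> B"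
    by (auto simp: beachball_E_def R_def A_def B_def)
  have "Suc i mod m < m" for i
    using assms(1) by simp
  then have rim: "Suc i mod m \<noteq> m" "Suc i mod m \<noteq> Suc m" for i
    by (metis less_irrefl, metis not_less_eq less_Suc_eq)
  show "R \<inter> A = {}" "(R \<union> A) \<inter> B = {}"
    using rim rim[symmetric] by (auto simp: R_def A_def B_def doubleton_eq_iff)
  show "inj_on (\<lambda>i. {i, Suc i mod m}) {..<m}"
    using assms(1) by (intro inj_onI) (auto simp: doubleton_eq_iff mod_Suc split: if_splits)
  show "inj_on (\<lambda>i. {i, m}) {..<m}" "inj_on (\<lambda>i. {i, Suc m}) {..<m}"
    by (intro inj_onI; simp add: doubleton_eq_iff)+
qed

lemma card_beachball_E:
  assumes "3 \<le> m"
  shows "card (beachball_E m) = 3 * m"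
proof -
  note d = beachball_E_decomp[OF assms]
  show ?thesis
    unfolding d(1) using d(2-6) by (simp add: card_Un_disjoint card_image)
qed

lemma prod_beachball_E:
  fixes h :: "nat set \<Rightarrow> real"
  assumes "3 \<le> m"
  shows "(\<Prod>e\<in>beachball_E m. h e) = (\<Prod>i<m. h {i, Suc i mod m} * (h {i, Suc m} * h {i, m}))"
proof -
  note d = beachball_E_decomp[OF assms]
  have "(\<Prod>e\<in>beachball_E m. h e)
      = (\<Prod>i<m. h {i, Suc i mod m}) * (\<Prod>i<m. h {i, m}) * (\<Prod>i<m. h {i, Suc m})"
    unfolding d(1) using d(2-6) by (simp add: prod.union_disjoint prod.reindex)
  then show ?thesis
    by (simp add: prod.distrib ac_simps)
qed

lemma prob_space_unit_interval: "prob_space unit_interval"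
proof (rule prob_spaceI)
  have "emeasure (restrict_space lborel {0..1::real}) {0..1} = emeasure lborel {0..1::real}"
    by (rule emeasure_restrict_space) auto
  then show "emeasure unit_interval (space unit_interval) = 1"
    by (simp add: unit_interval_def space_restrict_space)
qed

text \<open>Sampled points lie in the unit interval, where \<open>W\<close> and \<open>U\<close>
  agree, so a function controlled only on the unit square may be replaced by a globally bounded
  kernel.\<close>

lemma hom_density_beachball:
  assumes "3 \<le> m" and sym: "\<And>x y. W x y = W y x" and U: "unit_kernel unit_interval U"
    and eq: "\<And>x y. x \<in> {0..1} \<Longrightarrow> y \<in> {0..1} \<Longrightarrow> W x y = U x y"
  shows "hom_density (beachball_V m) (beachball_E m) W
    = (\<integral>p. cycle_codegree unit_interval m U (fst p) (snd p) \<partial>(unit_interval \<Otimes>\<^sub>M unit_interval))"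
proof -
  have "hom_density (beachball_V m) (beachball_E m) W
    = (\<integral>x. (\<Prod>i<m. U (x i) (x (Suc i mod m)) * (U (x (Suc m)) (x i) * U (x m) (x i)))
      \<partial>Pi\<^sub>M {0..<m + 2} (\<lambda>_. unit_interval))"
    unfolding hom_density_def beachball_V_def
  proof (rule Bochner_Integration.integral_cong[OF refl])
    fix x assume "x \<in> space (Pi\<^sub>M {0..<m + 2} (\<lambda>_. unit_interval))"
    then have x: "x i \<in> {0..1}" if "i < m + 2" for i
      using that by (auto simp: space_PiM PiE_def Pi_def unit_interval_def space_restrict_space)
    \<comment> \<open>Symmetry of \<open>W\<close> removes the orientation that \<open>Min\<close>
      and \<open>Max\<close> impose on an edge.\<close>
    have pair: "W (x (Min {i, j})) (x (Max {i, j})) = U (x i) (x j)" if "i < m + 2" "j < m + 2" for i j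
      using sym[of "x i" "x j"] eq[OF x x, OF that] by (cases "i \<le> j") (auto simp: min_def max_def)
    have swap: "U (x i) (x j) = U (x j) (x i)" if "i < m + 2" "j < m + 2" for i j
      using sym[of "x i" "x j"] eq[OF x x, of i j] eq[OF x x, of j i] that by simp
    have "Suc i mod m < m + 2" for i
      using assms(1) mod_less_divisor[of m "Suc i"] by linarith
    then show "(\<Prod>e\<in>beachball_E m. W (x (Min e)) (x (Max e)))
      = (\<Prod>i<m. U (x i) (x (Suc i mod m)) * (U (x (Suc m)) (x i) * U (x m) (x i)))"
      unfolding prod_beachball_E[OF assms(1)]
      by (intro prod.cong) (auto simp: pair swap[of "Suc m"] swap[of m] simp del: Min_insert Max_insert)
  qed
  then show ?thesis
    by (simp only: prob_space.integral_two_apexes[OF prob_space_unit_interval U])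
qed

theorem theorem4p3:
  fixes k :: nat
  assumes "k \<ge> 2"
  shows "common (beachball_V (2 * k)) (beachball_E (2 * k))"
  unfolding common_def
proof (intro allI impI)
  fix W assume "graphon W"
  then have meas: "(\<lambda>(x, y). W x y) \<in> borel_measurable borel" and sym: "\<And>x y. W x y = W y x"
    and bounds: "\<And>x y. x \<in> {0..1} \<Longrightarrow> y \<in> {0..1} \<Longrightarrow> 0 \<le> W x y \<and> W x y \<le> 1"
    by (auto simp: graphon_def)
  \<comment> \<open>A graphon is unconstrained outside the unit square, hence the truncation.\<close>
  define U where "U x y = max 0 (min 1 (W x y))" for x y
  have id: "(\<lambda>x. x) \<in> measurable unit_interval borel"
    unfolding unit_interval_def by (intro measurable_restrict_space1) simp
  have "(\<lambda>p. (fst p, snd p)) \<in> measurable (unit_interval \<Otimes>\<^sub>M unit_interval) (borel \<Otimes>\<^sub>M borel)"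
    by (intro measurable_Pair measurable_compose[OF measurable_fst id]
        measurable_compose[OF measurable_snd id])
  from measurable_compose[OF this, of "\<lambda>(x, y). W x y" borel] meas
  have "(\<lambda>p. W (fst p) (snd p)) \<in> borel_measurable (unit_interval \<Otimes>\<^sub>M unit_interval)"
    by (simp add: borel_prod)
  then have U: "unit_kernel unit_interval U"
    unfolding unit_kernel_def U_def by (auto simp: case_prod_beta')
  then have U': "unit_kernel unit_interval (\<lambda>x y. 1 - U x y)"
    unfolding unit_kernel_def case_prod_beta' by (auto simp: U_def)
  have U_sym: "U x y = U y x" for x y
    unfolding U_def using sym[of x y] by simp
  have U_nonneg: "0 \<le> U x y" for x y
    by (simp add: U_def)
  have W_eq: "W x y = U x y" if "x \<in> {0..1}" "y \<in> {0..1}" for x y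
    using bounds[OF that] by (simp add: U_def)
  have "m_density (beachball_V (2 * k)) (beachball_E (2 * k)) W =
    (\<integral>p. cycle_codegree unit_interval (2 * k) U (fst p) (snd p) \<partial>(unit_interval \<Otimes>\<^sub>M unit_interval))
    + (\<integral>p. cycle_codegree unit_interval (2 * k) (\<lambda>x y. 1 - U x y) (fst p) (snd p)
        \<partial>(unit_interval \<Otimes>\<^sub>M unit_interval))"
    unfolding m_density_def using assms sym W_eq
    by (intro arg_cong2[where f="(+)"] hom_density_beachball U U') auto
  then have ge: "2 \<le> 64 ^ k * m_density (beachball_V (2 * k)) (beachball_E (2 * k)) W"
    using prob_space.cycle_codegree_sum_ge[OF prob_space_unit_interval U U_sym U_nonneg assms]
    by (simp only:)
  \<comment> \<open>There are \<open>3 * (2 * k) = 6 * k\<close> edges and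
    \<open>2 ^ 6 = 64\<close>, which is the normalisation used in
    \<open>cycle_codegree_sum_ge\<close>.\<close>
  have "2 powr (1 - real (card (beachball_E (2 * k)))) = 2 / 64 ^ k"
  proof -
    have "card (beachball_E (2 * k)) = 6 * k"
      using assms card_beachball_E[of "2 * k"] by simp
    then have "2 powr (1 - real (card (beachball_E (2 * k)))) = 2 / 2 powr real (6 * k)"
      by (simp add: powr_diff)
    also have "\<dots> = 2 / 64 ^ k"
      by (simp only: powr_realpow power_mult) simp
    finally show ?thesis .
  qed
  also have "2 / 64 ^ k \<le> m_density (beachball_V (2 * k)) (beachball_E (2 * k)) W"
    using ge by (simp add: divide_le_eq mult.commute)
  finally show "2 powr (1 - real (card (beachball_E (2 * k))))
      \<le> m_density (beachball_V (2 * k)) (beachball_E (2 * k)) W" .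
qed

end
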